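(* Let $A=(a_{ij})$ be an invertible real $2\times2$ matrix, $b\in\mathbb{R}^2$, $c=-A^{-1}b$, and suppose that the eigenvalues $\lambda_1,\lambda_2$ of $\operatorname{diag}(c)A$ are real, negative, and linearly independent over $\mathbb{Q}$. Let $\alpha^{n_1,n_2}=(\alpha_1^{n_1,n_2},\alpha_2^{n_1,n_2})\in\mathbb{R}^2$, $n_1,n_2\ge0$, be the coefficients of the formal series $x_i(t)=\sum_{n_1,n_2\ge0}\alpha_i^{n_1,n_2}e^{(n_1\lambda_1+n_2\lambda_2)t}$, $i=1,2$, generated by the spectral power series recursion (defined in the context) for the system $\dot x=\operatorname{diag}(x)(b+Ax)$. Then there exists a constant $K$ such that for all integers $n_1,n_2\ge0$ with $(n_1,n_2)\ne(0,0)$, $$|\alpha_1^{n_1,n_2}|<\frac{K^{n_1+n_2}}{(n_1+1)(n_2+1)},\qquad |\alpha_2^{n_1,n_2}|<\frac{K^{n_1+n_2}}{(n_1+1)(n_2+1)}.$$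
   Context: The system is $\dot x_1=b_1x_1+a_{11}x_1^2+a_{12}x_1x_2$, $\dot x_2=b_2x_2+a_{21}x_1x_2+a_{22}x_2^2$. For a vector $v$, $\operatorname{diag}(v)$ is the diagonal matrix with diagonal $v$. Spectral power series recursion (obtained by substituting the series into the system and equating coefficients of like exponentials): (1) $\alpha^{0,0}=c$. (2) $\alpha^{1,0}$ is an arbitrarily chosen vector with $\operatorname{diag}(c)A\,\alpha^{1,0}=\lambda_1\alpha^{1,0}$, and $\alpha^{0,1}$ is an arbitrarily chosen vector with $\operatorname{diag}(c)A\,\alpha^{0,1}=\lambda_2\alpha^{0,1}$. (3) For every other $(n_1,n_2)$ (different from $(0,0),(1,0),(0,1)$), $\alpha^{n_1,n_2}$ is the unique solution of $$\big((n_1\lambda_1+n_2\lambda_2)I-\operatorname{diag}(c)A\big)\alpha^{n_1,n_2}=\begin{pmatrix}a_{11}S_{1,1}^{n_1,n_2}+a_{12}S_{1,2}^{n_1,n_2}\\ a_{21}S_{1,2}^{n_1,n_2}+a_{22}S_{2,2}^{n_1,n_2}\end{pmatrix},$$ where, for $p,q\in\{1,2\}$, $$S_{p,q}^{n_1,n_2}=\sum_{\substack{0\le i\le n_1,\ 0\le j\le n_2\\ (i,j)\neq(0,0),(n_1,n_2)}}\alpha_p^{i,j}\,\alpha_q^{n_1-i,n_2-j}.$$ (The matrix on the left is invertible for these $(n_1,n_2)$ under the assumptions.) The constant $K$ may depend on $A$, $b$, $\alpha^{1,0}$ and $\alpha^{0,1}$. *)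

theory Defs
  imports "HOL-Analysis.Analysis"
begin

definition diag :: "'a::zero ^ 'n \<Rightarrow> 'a ^ 'n ^ 'n" where
  "diag v = (\<chi> i j. if i = j then v $ i else 0)"

definition eigenvalues :: "'a::field ^ 'n ^ 'n \<Rightarrow> 'a set" where
  "eigenvalues M = {l. \<exists>v. v \<noteq> 0 \<and> M *v v = l *s v}"

text \<open>Linear independence over the rationals of the pair (a family, not the set
  of its entries), so in particular the two numbers are distinct.\<close>

definition lin_indep_rat :: "real \<Rightarrow> real \<Rightarrow> bool" where
  "lin_indep_rat x y \<longleftrightarrow>
    (\<forall>p q :: rat. of_rat p * x + of_rat q * y = 0 \<longrightarrow> p = 0 \<and> q = 0)"

definition conv_sum :: "(nat \<Rightarrow> nat \<Rightarrow> real ^ 2) \<Rightarrow> 2 \<Rightarrow> 2 \<Rightarrow> nat \<Rightarrow> nat \<Rightarrow> real" where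
  "conv_sum \<alpha> p q n1 n2 =
    (\<Sum>(i, j) \<in> {0..n1} \<times> {0..n2} - {(0, 0), (n1, n2)}.
       \<alpha> i j $ p * \<alpha> (n1 - i) (n2 - j) $ q)"

text \<open>The family \<open>\<alpha>\<close> is generated by the spectral power series recursion of the system
  \<open>x' = diag x (b + A x)\<close> at the equilibrium \<open>c\<close>, for some choice of the
  (possibly zero) vectors \<open>\<alpha> 1 0\<close> and \<open>\<alpha> 0 1\<close>; these are left unconstrained
  up to the eigenvector equations. The vector \<open>b\<close> enters only through \<open>c\<close>. That the
  linear systems in the third clause have exactly one solution is the
  lemma \<open>recursion_matrix_invertible\<close> below.\<close>

definition spectral_recursion ::
  "real ^ 2 ^ 2 \<Rightarrow> real ^ 2 \<Rightarrow> real \<Rightarrow> real \<Rightarrow> (nat \<Rightarrow> nat \<Rightarrow> real ^ 2) \<Rightarrow> bool" where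
  "spectral_recursion A c l1 l2 \<alpha> \<longleftrightarrow>
     \<alpha> 0 0 = c \<and>
     (diag c ** A) *v \<alpha> 1 0 = l1 *\<^sub>R \<alpha> 1 0 \<and>
     (diag c ** A) *v \<alpha> 0 1 = l2 *\<^sub>R \<alpha> 0 1 \<and>
     (\<forall>n1 n2. (n1, n2) \<notin> {(0, 0), (1, 0), (0, 1)} \<longrightarrow>
        ((real n1 * l1 + real n2 * l2) *\<^sub>R mat 1 - diag c ** A) *v \<alpha> n1 n2 =
        vector
          [A $ 1 $ 1 * conv_sum \<alpha> 1 1 n1 n2 + A $ 1 $ 2 * conv_sum \<alpha> 1 2 n1 n2,
           A $ 2 $ 1 * conv_sum \<alpha> 1 2 n1 n2 + A $ 2 $ 2 * conv_sum \<alpha> 2 2 n1 n2])"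

lemma recursion_matrix_invertible:
  fixes M :: "real ^ 2 ^ 2"
  assumes ev: "eigenvalues (map_matrix complex_of_real M) = {complex_of_real l1, complex_of_real l2}"
    and ind: "lin_indep_rat l1 l2"
    and n: "(n1, n2) \<notin> {(0, 0), (1, 0), (0, 1)}"
  shows "invertible ((real n1 * l1 + real n2 * l2) *\<^sub>R mat 1 - M)"
proof (rule ccontr)
  let ?m = "real n1 * l1 + real n2 * l2"
  assume "\<not> invertible (?m *\<^sub>R mat 1 - M)"
  then obtain v where v: "v \<noteq> 0" "(?m *\<^sub>R mat 1 - M) *v v = 0"
    unfolding invertible_left_inverse matrix_left_invertible_ker by blast
  have Mv: "M *v v = ?m *\<^sub>R v"
    using v(2) by (simp add: matrix_vector_mult_diff_rdistrib scaleR_matrix_vector_assoc [symmetric])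
  define w :: "complex ^ 2" where "w = (\<chi> i. complex_of_real (v $ i))"
  have "w \<noteq> 0"
    using v(1) by (auto simp: w_def vec_eq_iff)
  moreover have "map_matrix complex_of_real M *v w = complex_of_real ?m *s w"
  proof (rule vec_eq_iff [THEN iffD2], rule allI)
    fix i
    have "(map_matrix complex_of_real M *v w) $ i = complex_of_real ((M *v v) $ i)"
      by (simp add: matrix_vector_mult_def map_matrix_def w_def)
    then show "(map_matrix complex_of_real M *v w) $ i = (complex_of_real ?m *s w) $ i"
      by (simp add: Mv w_def algebra_simps)
  qed
  ultimately have "complex_of_real ?m \<in> eigenvalues (map_matrix complex_of_real M)"
    unfolding eigenvalues_def by blast
  then have "?m = l1 \<or> ?m = l2"
    unfolding ev by (metis insertE singletonD of_real_eq_iff)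
  then show False
  proof
    assume "?m = l1"
    then have "of_rat (of_nat n1 - 1) * l1 + of_rat (of_nat n2) * l2 = 0"
      by (simp add: of_rat_diff algebra_simps)
    then have "of_nat n1 - 1 = (0::rat) \<and> of_nat n2 = (0::rat)"
      using ind unfolding lin_indep_rat_def by blast
    then show False using n by auto
  next
    assume "?m = l2"
    then have "of_rat (of_nat n1) * l1 + of_rat (of_nat n2 - 1) * l2 = 0"
      by (simp add: of_rat_diff algebra_simps)
    then have "of_nat n1 = (0::rat) \<and> of_nat n2 - 1 = (0::rat)"
      using ind unfolding lin_indep_rat_def by blast
    then show False using n by auto
  qed
qed

end

theory Submission
  imports Defs
begin

text \<open>Since \<open>l1\<close> and \<open>l2\<close> are negative, the numbers \<open>n1 * l1 + n2 * l2\<close> tend to \<open>-\<infinity>\<close>, so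
  there are no small divisors: the inverses of the recursion matrices are uniformly bounded. Hence
  the coefficients are dominated by a multiple of their own convolution square. The weight
  \<open>1 / (n + 1)\<^sup>2\<close> is reproduced, up to the factor 8, by convolution with itself, so the bound
  \<open>\<epsilon> * K ^ (n1 + n2) / ((n1 + 1)\<^sup>2 * (n2 + 1)\<^sup>2)\<close> propagates through the recursion as soon as \<open>\<epsilon>\<close> is
  small; the first two coefficients are accommodated by then taking \<open>K\<close> large.\<close>

text \<open>Telescoping: 1/(k+1)^2 is at most 1/k - 1/(k+1) for k > 0. The subtracted term carries
  the induction; only the uniform bound 2 is used later.\<close>

lemma sum_inverse_squares_le:
  "(\<Sum>i\<le>n. 1 / (real i + 1)^2) \<le> 2 - 1 / (real n + 1)"
proof (induction n)
  case 0
  show ?case by simp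
next
  case (Suc n)
  have "1 / (real n + 2)^2 \<le> 1 / ((real n + 1) * (real n + 2))"
    by (rule divide_left_mono) (auto simp: power2_eq_square)
  also have "\<dots> = 1 / (real n + 1) - 1 / (real n + 2)"
    by (simp add: divide_simps)
  finally show ?case
    using Suc.IH by (simp add: add.commute)
qed

text \<open>With x = i+1 and y = n-i+1, the quotient (x+y)/(xy) splits as 1/x + 1/y, whose square is
  at most 2/x^2 + 2/y^2. Each of the two resulting sums is at most 2, whence 8 = 2*2 + 2*2.\<close>

lemma inverse_square_convolution_le:
  "(\<Sum>i\<le>n. 1 / (real i + 1)^2 * (1 / (real (n - i) + 1)^2)) \<le> 8 / (real n + 1)^2"
proof -
  have "1 / (real i + 1)^2 * (1 / (real (n - i) + 1)^2) * (real n + 1)^2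
        \<le> 2 * (1 / (real i + 1)^2) + 2 * (1 / (real (n - i) + 1)^2)" if "i \<le> n" for i
  proof -
    define x y where "x = real i + 1" and "y = real (n - i) + 1"
    have pos: "x > 0" "y > 0" and n: "real n + 1 \<le> x + y"
      using that by (auto simp: x_def y_def of_nat_diff)
    have "1 / x^2 * (1 / y^2) * (real n + 1)^2 \<le> 1 / x^2 * (1 / y^2) * (x + y)^2"
      using n by (intro mult_left_mono power_mono) auto
    also have "\<dots> = (1 / x + 1 / y)^2"
      using pos by (simp add: field_simps power2_eq_square)
    also have "\<dots> \<le> 2 * (1 / x^2) + 2 * (1 / y^2)"
      using sum_squares_bound[of "1 / x" "1 / y"]
      by (simp add: power2_sum power_one_over)
    finally show ?thesis by (simp add: x_def y_def)
  qed
  then have "(\<Sum>i\<le>n. 1 / (real i + 1)^2 * (1 / (real (n - i) + 1)^2)) * (real n + 1)^2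
      \<le> (\<Sum>i\<le>n. 2 * (1 / (real i + 1)^2) + 2 * (1 / (real (n - i) + 1)^2))"
    unfolding sum_distrib_right by (intro sum_mono) auto
  also have "\<dots> = 2 * (\<Sum>i\<le>n. 1 / (real i + 1)^2) + 2 * (\<Sum>i\<le>n. 1 / (real (n - i) + 1)^2)"
    by (simp only: sum.distrib sum_distrib_left)
  also have "(\<Sum>i\<le>n. 1 / (real (n - i) + 1)^2) = (\<Sum>i\<le>n. 1 / (real i + 1)^2)"
    by (rule sum.reindex_bij_witness[of _ "\<lambda>i. n - i" "\<lambda>i. n - i"]) auto
  also have "2 * (\<Sum>i\<le>n. 1 / (real i + 1)^2) + 2 * (\<Sum>i\<le>n. 1 / (real i + 1)^2) \<le> 8"
    using sum_inverse_squares_le[of n] by (smt (verit) divide_nonneg_nonneg of_nat_0_le_iff)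
  finally show ?thesis
    by (subst pos_le_divide_eq) (auto intro: add_nonneg_pos)
qed

text \<open>The scalar form of the estimate, to be applied to the norms of the coefficients. The
  induction proves a bound with squared denominators, which is stable under convolution, and weakens
  it only at the end.\<close>

lemma convolution_recursion_bound:
  fixes u :: "nat \<Rightarrow> nat \<Rightarrow> real"
  assumes nonneg: "\<And>i j. 0 \<le> u i j"
    and "0 \<le> B"
    and rec: "\<And>n1 n2. (n1, n2) \<notin> {(0, 0), (1, 0), (0, 1)} \<Longrightarrow>
       u n1 n2 \<le> B * (\<Sum>(i, j) \<in> {0..n1} \<times> {0..n2} - {(0, 0), (n1, n2)}.
                        u i j * u (n1 - i) (n2 - j))"
  shows "\<exists>K>0. \<forall>n1 n2. (n1, n2) \<noteq> (0, 0) \<longrightarrow>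
           u n1 n2 < K ^ (n1 + n2) / (real (n1 + 1) * real (n2 + 1))"
proof -
  define w :: "nat \<Rightarrow> real" where "w n = 1 / (real n + 1)^2" for n
  \<comment> \<open>The constant 64 = 8 * 8 comes from one convolution in each index. The summand 2
    keeps \<open>e\<close> below 1, which makes the final inequality strict.\<close>
  define e where "e = 1 / (64 * B + 2)"
  \<comment> \<open>At (1, 0) and (0, 1) the weight is 1/4, so the factor 4/e turns the claimed
    bound into \<open>u 1 0 + u 0 1 + 1\<close>.\<close>
  define K where "K = 4 * (u 1 0 + u 0 1 + 1) / e"
  have e: "0 < e" "e < 1" "B * (64 * e) \<le> 1"
    using \<open>0 \<le> B\<close> by (auto simp: e_def field_simps)
  have K: "0 < K"
    using e nonneg[of 1 0] nonneg[of 0 1] by (simp add: K_def)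
  have w: "0 < w n" for n by (auto simp: w_def)
  have wconv: "(\<Sum>i\<le>n. w i * w (n - i)) \<le> 8 * w n" for n
    using inverse_square_convolution_le[of n] by (simp add: w_def)
  have bound: "u n1 n2 \<le> e * K ^ (n1 + n2) * (w n1 * w n2)" if "(n1, n2) \<noteq> (0, 0)" for n1 n2
    using that
  proof (induction "n1 + n2" arbitrary: n1 n2 rule: less_induct)
    case less
    show ?case
    proof (cases "(n1, n2) \<in> {(0, 0), (1, 0), (0, 1)}")
      case True
      have eK: "e * K = 4 * (u 1 0 + u 0 1 + 1)"
        using e by (simp add: K_def)
      show ?thesis
        using True less.prems eK nonneg[of 1 0] nonneg[of 0 1] by (auto simp: w_def)
    next
      case False
      let ?T = "{0..n1} \<times> {0..n2}"
      let ?S = "?T - {(0, 0), (n1, n2)}"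
      let ?g = "\<lambda>(i, j). (w i * w (n1 - i)) * (w j * w (n2 - j))"
      have summand: "u i j * u (n1 - i) (n2 - j) \<le> e^2 * K ^ (n1 + n2) * ?g (i, j)"
        if "(i, j) \<in> ?S" for i j
      proof -
        from that have ij: "i \<le> n1" "j \<le> n2" "(i, j) \<noteq> (0, 0)" "(i, j) \<noteq> (n1, n2)" by auto
        \<comment> \<open>Omitting the corner (n1, n2) makes i + j smaller than n1 + n2 and the
          complementary index nonzero; omitting (0, 0) does the same with the roles exchanged. Hence
          the induction hypothesis covers both factors.\<close>
        then have "u i j \<le> e * K ^ (i + j) * (w i * w j)"
          by (intro less.hyps) auto
        moreover have "u (n1 - i) (n2 - j) \<le>
            e * K ^ (n1 - i + (n2 - j)) * (w (n1 - i) * w (n2 - j))"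
          using ij by (intro less.hyps) auto
        ultimately have "u i j * u (n1 - i) (n2 - j) \<le> (e * K ^ (i + j) * (w i * w j)) *
            (e * K ^ (n1 - i + (n2 - j)) * (w (n1 - i) * w (n2 - j)))"
          using e K w by (intro mult_mono nonneg mult_nonneg_nonneg) (auto intro: less_imp_le)
        also have "\<dots> = e^2 * K ^ ((i + j) + (n1 - i + (n2 - j))) * ?g (i, j)"
          unfolding power_add power2_eq_square by (simp add: mult_ac)
        also have "(i + j) + (n1 - i + (n2 - j)) = n1 + n2"
          using ij by simp
        finally show ?thesis .
      qed
      have "(\<Sum>(i, j) \<in> ?S. u i j * u (n1 - i) (n2 - j))
          \<le> (\<Sum>p \<in> ?S. e^2 * K ^ (n1 + n2) * ?g p)"
        by (intro sum_mono) (use summand in \<open>simp only: split_paired_all prod.case\<close>)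
      \<comment> \<open>Restoring the two nonnegative corner terms gives a full rectangle, over
        which the sum factors into two one-dimensional convolutions.\<close>
      also have "\<dots> \<le> (\<Sum>p \<in> ?T. e^2 * K ^ (n1 + n2) * ?g p)"
        using e K w by (intro sum_mono2) (auto simp: split_def intro!: mult_nonneg_nonneg less_imp_le)
      also have "\<dots> = e^2 * K ^ (n1 + n2) *
          ((\<Sum>i\<le>n1. w i * w (n1 - i)) * (\<Sum>j\<le>n2. w j * w (n2 - j)))"
        unfolding sum_product sum.cartesian_product atLeast0AtMost
        by (simp only: sum_distrib_left)
      also have "\<dots> \<le> e^2 * K ^ (n1 + n2) * ((8 * w n1) * (8 * w n2))"
        using e K w wconv
        by (intro mult_left_mono mult_mono sum_nonneg mult_nonneg_nonneg) (auto intro: less_imp_le)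
      finally have "u n1 n2 \<le> B * (e^2 * K ^ (n1 + n2) * ((8 * w n1) * (8 * w n2)))"
        using rec[OF False] \<open>0 \<le> B\<close> by (meson mult_left_mono order_trans)
      \<comment> \<open>The product of two bounds carries \<open>e^2\<close>; the spare factor
        \<open>e\<close> absorbs 64 and \<open>B\<close>.\<close>
      also have "\<dots> = (B * (64 * e)) * (e * K ^ (n1 + n2) * (w n1 * w n2))"
        by (simp add: power2_eq_square)
      also have "\<dots> \<le> 1 * (e * K ^ (n1 + n2) * (w n1 * w n2))"
        using e K w by (intro mult_right_mono) (auto intro!: mult_nonneg_nonneg less_imp_le)
      finally show ?thesis by simp
    qed
  qed
  have w_le: "w n \<le> 1 / real (n + 1)" for n
    using self_le_power[of "real (n + 1)" 2]
    unfolding w_def by (intro divide_left_mono) (simp_all add: add.commute)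
  have "u n1 n2 < K ^ (n1 + n2) / (real (n1 + 1) * real (n2 + 1))"
    if "(n1, n2) \<noteq> (0, 0)" for n1 n2
  proof -
    note bound[OF that]
    also have "e * K ^ (n1 + n2) * (w n1 * w n2) < 1 * K ^ (n1 + n2) * (w n1 * w n2)"
      using e K w by (intro mult_strict_right_mono) auto
    also have "\<dots> \<le> 1 * K ^ (n1 + n2) * (1 / real (n1 + 1) * (1 / real (n2 + 1)))"
      using K w w_le by (intro mult_left_mono mult_mono) (auto intro: less_imp_le)
    finally show ?thesis by simp
  qed
  with K show ?thesis by blast
qed

lemma invertible_bounded_below:
  fixes P :: "real ^ 'n ^ 'n"
  assumes "invertible P"
  obtains B where "\<And>x. norm x \<le> B * norm (P *v x)"
proof -
  obtain Q where Q: "Q ** P = mat 1"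
    using assms invertible_def by blast
  have "norm x \<le> onorm ((*v) Q) * norm (P *v x)" for x
    using onorm[OF matrix_vector_mul_bounded_linear, of Q "P *v x"]
    by (simp add: matrix_vector_mul_assoc Q)
  then show thesis using that by blast
qed

text \<open>Outside a finite box of indices the scalar part exceeds the operator norm of
  \<open>M\<close> by at least 1. Inside the box there are finitely many matrices, each invertible
  by rational independence.\<close>

lemma recursion_matrix_bounded_below:
  fixes M :: "real ^ 2 ^ 2"
  assumes ev: "eigenvalues (map_matrix complex_of_real M) = {complex_of_real l1, complex_of_real l2}"
    and neg: "l1 < 0" "l2 < 0"
    and ind: "lin_indep_rat l1 l2"
  obtains B where "0 \<le> B"
    and "\<And>n1 n2 x. (n1, n2) \<notin> {(0, 0), (1, 0), (0, 1)} \<Longrightarrow>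
           norm x \<le> B * norm (((real n1 * l1 + real n2 * l2) *\<^sub>R mat 1 - M) *v x)"
proof -
  let ?P = "\<lambda>n1 n2. (real n1 * l1 + real n2 * l2) *\<^sub>R mat 1 - M"
  define R where "R = onorm ((*v) M) + 1"
  define N1 N2 where "N1 = nat \<lceil>R / - l1\<rceil>" and "N2 = nat \<lceil>R / - l2\<rceil>"
  have "\<exists>B. \<forall>x. norm x \<le> B * norm (?P n1 n2 *v x)"
    if "(n1, n2) \<notin> {(0, 0), (1, 0), (0, 1)}" for n1 n2
    using invertible_bounded_below[OF recursion_matrix_invertible[OF ev ind that]] by metis
  then obtain B where B: "\<And>n1 n2 x. (n1, n2) \<notin> {(0, 0), (1, 0), (0, 1)} \<Longrightarrow>
      norm x \<le> B n1 n2 * norm (?P n1 n2 *v x)"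
    by metis
  \<comment> \<open>The summand 1 serves the indices outside the box. Absolute values are taken
    because the chosen \<open>B i j\<close> may be negative, and is arbitrary at the three excluded
    indices.\<close>
  define C where "C = 1 + (\<Sum>(i, j) \<in> {..N1} \<times> {..N2}. \<bar>B i j\<bar>)"
  have C: "1 \<le> C" by (auto simp: C_def intro!: sum_nonneg)
  have "norm x \<le> C * norm (?P n1 n2 *v x)"
    if n: "(n1, n2) \<notin> {(0, 0), (1, 0), (0, 1)}" for n1 n2 x
  proof (cases "n1 \<le> N1 \<and> n2 \<le> N2")
    case True
    then have "\<bar>B n1 n2\<bar> \<le> (\<Sum>(i, j) \<in> {..N1} \<times> {..N2}. \<bar>B i j\<bar>)"
      using member_le_sum[of "(n1, n2)" "{..N1} \<times> {..N2}" "\<lambda>(i, j). \<bar>B i j\<bar>"] by auto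
    then have "B n1 n2 \<le> C" by (simp add: C_def)
    then show ?thesis
      using B[OF n, of x] by (meson mult_right_mono norm_ge_zero order_trans)
  next
    case False
    let ?m = "real n1 * l1 + real n2 * l2"
    have "R / - l1 < real n1 \<or> R / - l2 < real n2"
      using False unfolding N1_def N2_def by linarith
    then have "R < real n1 * - l1 \<or> R < real n2 * - l2"
      using neg pos_divide_less_eq[of "- l1" R] pos_divide_less_eq[of "- l2" R] by auto
    \<comment> \<open>Both terms have the same sign, so they cannot cancel and one large term
      suffices.\<close>
    moreover have "real n1 * l1 \<le> 0" "real n2 * l2 \<le> 0"
      using neg by (simp_all add: mult_nonneg_nonpos)
    ultimately have m: "R \<le> \<bar>?m\<bar>"
      unfolding mult_minus_right by (elim disjE) linarith+
    have Mx: "norm (M *v x) \<le> onorm ((*v) M) * norm x"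
      by (rule onorm[OF matrix_vector_mul_bounded_linear])
    have "?P n1 n2 *v x = ?m *\<^sub>R x - M *v x"
      by (simp add: matrix_vector_mult_diff_rdistrib scaleR_matrix_vector_assoc [symmetric])
    then have "\<bar>?m\<bar> * norm x - norm (M *v x) \<le> norm (?P n1 n2 *v x)"
      by (metis norm_scaleR norm_triangle_ineq2)
    moreover have "R * norm x \<le> \<bar>?m\<bar> * norm x"
      using m by (simp add: mult_right_mono)
    ultimately have "norm x \<le> norm (?P n1 n2 *v x)"
      using Mx by (simp add: R_def algebra_simps)
    also have "\<dots> \<le> C * norm (?P n1 n2 *v x)"
      using C by (simp add: mult_le_cancel_right1)
    finally show ?thesis .
  qed
  with C that[of C] show thesis by force
qed

text \<open>The majorant does not depend on \<open>p\<close> and \<open>q\<close>, so one sum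
  controls every convolution on the right-hand side of the recursion.\<close>

lemma abs_conv_sum_le:
  "\<bar>conv_sum \<alpha> p q n1 n2\<bar> \<le> (\<Sum>(i, j) \<in> {0..n1} \<times> {0..n2} - {(0, 0), (n1, n2)}.
      norm (\<alpha> i j) * norm (\<alpha> (n1 - i) (n2 - j)))"
  unfolding conv_sum_def
  by (rule order_trans[OF sum_abs], rule sum_mono)
     (auto simp: abs_mult intro!: mult_mono component_le_norm_cart)

theorem theorem2p5:
  fixes A :: "real ^ 2 ^ 2" and b c :: "real ^ 2" and l1 l2 :: real
    and \<alpha> :: "nat \<Rightarrow> nat \<Rightarrow> real ^ 2"
  assumes "invertible A"
    and "c = - (matrix_inv A *v b)"
    and "eigenvalues (map_matrix complex_of_real (diag c ** A)) =
           {complex_of_real l1, complex_of_real l2}"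
    and "l1 < 0" and "l2 < 0"
    and "lin_indep_rat l1 l2"
    and "spectral_recursion A c l1 l2 \<alpha>"
  shows "\<exists>K :: real. \<forall>n1 n2 :: nat. (n1, n2) \<noteq> (0, 0) \<longrightarrow>
           \<bar>\<alpha> n1 n2 $ 1\<bar> < K ^ (n1 + n2) / (real (n1 + 1) * real (n2 + 1)) \<and>
           \<bar>\<alpha> n1 n2 $ 2\<bar> < K ^ (n1 + n2) / (real (n1 + 1) * real (n2 + 1))"
proof -
  obtain B where "0 \<le> B" and B: "\<And>n1 n2 x. (n1, n2) \<notin> {(0, 0), (1, 0), (0, 1)} \<Longrightarrow>
      norm x \<le> B * norm (((real n1 * l1 + real n2 * l2) *\<^sub>R mat 1 - diag c ** A) *v x)"
    using recursion_matrix_bounded_below[OF assms(3-6)] by metis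
  define a where "a = (\<bar>A $ 1 $ 1\<bar> + \<bar>A $ 1 $ 2\<bar>) + (\<bar>A $ 2 $ 1\<bar> + \<bar>A $ 2 $ 2\<bar>)"
  have rec: "norm (\<alpha> n1 n2) \<le> (B * a) * (\<Sum>(i, j) \<in> {0..n1} \<times> {0..n2} - {(0, 0), (n1, n2)}.
      norm (\<alpha> i j) * norm (\<alpha> (n1 - i) (n2 - j)))" (is "_ \<le> _ * ?S")
    if n: "(n1, n2) \<notin> {(0, 0), (1, 0), (0, 1)}" for n1 n2
  proof -
    define r :: "real ^ 2" where "r = vector
          [A $ 1 $ 1 * conv_sum \<alpha> 1 1 n1 n2 + A $ 1 $ 2 * conv_sum \<alpha> 1 2 n1 n2,
           A $ 2 $ 1 * conv_sum \<alpha> 1 2 n1 n2 + A $ 2 $ 2 * conv_sum \<alpha> 2 2 n1 n2]"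
    have summand: "\<bar>x * conv_sum \<alpha> p q n1 n2\<bar> \<le> \<bar>x\<bar> * ?S" for x p q
      unfolding abs_mult by (intro mult_left_mono abs_conv_sum_le) simp
    have "norm r \<le> \<bar>r $ 1\<bar> + \<bar>r $ 2\<bar>"
      using norm_le_l1_cart[of r] by (simp add: sum_2)
    also have "\<dots> \<le>
        (\<bar>A $ 1 $ 1 * conv_sum \<alpha> 1 1 n1 n2\<bar> + \<bar>A $ 1 $ 2 * conv_sum \<alpha> 1 2 n1 n2\<bar>) +
        (\<bar>A $ 2 $ 1 * conv_sum \<alpha> 1 2 n1 n2\<bar> + \<bar>A $ 2 $ 2 * conv_sum \<alpha> 2 2 n1 n2\<bar>)"
      unfolding r_def vector_2 by (intro add_mono abs_triangle_ineq)
    also have "\<dots> \<le> a * ?S"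
      unfolding a_def distrib_right by (intro add_mono summand)
    finally have "norm r \<le> a * ?S" .
    then have "B * norm r \<le> (B * a) * ?S"
      unfolding mult.assoc using \<open>0 \<le> B\<close> by (rule mult_left_mono)
    \<comment> \<open>By the recursion, \<open>r\<close> is the recursion matrix applied to
      \<open>\<alpha> n1 n2\<close>, so the uniform lower bound applies.\<close>
    moreover have "norm (\<alpha> n1 n2) \<le> B * norm r"
      using B[OF n, of "\<alpha> n1 n2"] assms(7) n unfolding spectral_recursion_def r_def by auto
    ultimately show ?thesis
      by (rule order_trans[rotated])
  qed
  have "0 \<le> B * a"
    using \<open>0 \<le> B\<close> by (simp add: a_def)
  from convolution_recursion_bound[of "\<lambda>i j. norm (\<alpha> i j)", OF _ this rec]
  obtain K where "\<And>n1 n2. (n1, n2) \<noteq> (0, 0) \<Longrightarrow>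
      norm (\<alpha> n1 n2) < K ^ (n1 + n2) / (real (n1 + 1) * real (n2 + 1))"
    by auto
  then show ?thesis
    by (meson component_le_norm_cart le_less_trans)
qed

end
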